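(* Let $U_+$ and $U_-$ be two unitary operators in a Hilbert space $\mathcal H$ such that $$\bigcap_{\lambda\in\mathbb C\setminus\mathbb T}\ker\left((U_+-\lambda I_{\mathcal H})^{-1}-(U_--\lambda I_{\mathcal H})^{-1}\right)=\{0\}$$ and such that there is $n\in\mathbb N$ with $$\dim\operatorname{ran}\left((U_+-\lambda I_{\mathcal H})^{-1}-(U_--\lambda I_{\mathcal H})^{-1}\right)=n\quad\text{for all }\lambda\in\mathbb C\setminus\mathbb T.$$ Let $B\in\mathbb C^{n\times n}$ and $C:\mathcal H\to\mathbb C^n$ be the operators of the model of the pair $(U_+,U_-)$ and let $\Phi$ be the associated Carathéodory function. Then, for every $\lambda\in\mathbb C\setminus\mathbb T$, $$(\det B^{-1})\,\det\left((U_+-\lambda I_{\mathcal H})^{-1}(U_--\lambda I_{\mathcal H})\right)=\det\Phi(\lambda)$$ and $$\operatorname{Tr}\left((U_+-\lambda I_{\mathcal H})^{-1}-(U_--\lambda I_{\mathcal H})^{-1}\right)=\operatorname{Tr}\left(\Phi^{-1}(\lambda)\Phi'(\lambda)\right).$$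
   Context: $\mathbb T$ is the unit circle in $\mathbb C$. Hilbert spaces are complex. Model and associated Carathéodory function: under the two hypotheses on $U_\pm$, there exist a continuous linear operator $C:\mathcal H\to\mathbb C^n$ and a unitary matrix $B\in\mathbb C^{n\times n}$ such that $$I_{\mathcal H}-U_+^*U_-=-C^*BC,\qquad B^{-1}+B^{-*}=-CC^*,$$ where $B^{-*}=(B^{-1})^*$. Fix such a pair $(B,C)$. The Carathéodory function associated to $(U_+,U_-)$ is $$\Phi(\lambda)=B^{-1}+C(I_{\mathcal H}-\lambda U_+^* )^{-1}C^*,\qquad \lambda\in\mathbb C\setminus\mathbb T.$$ It has positive semidefinite real part in the open unit disk, satisfies $\Phi(\lambda)=-(\Phi(1/\overline{\lambda}))^*$ for $|\lambda|>1$, and is invertible with $\Phi^{-1}(\lambda)=B+BC(I_{\mathcal H}-\lambda U_-^* )^{-1}C^*B^*$. The determinant on the left-hand side is the determinant of an operator of the form identity plus finite rank. *)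

theory Defs
  imports "HOL-Analysis.Analysis" "HOL-Combinatorics.Permutations"
begin

section \<open>Complex Hilbert spaces\<close>

text \<open>The inner product is linear in the first argument. Completeness comes from the superclass
  \<^class>\<open>banach\<close>; nonnegativity and definiteness of the inner product follow from the axiom on the
  norm.\<close>

class complex_hilbert = banach +
  fixes scaleC :: "complex \<Rightarrow> 'a \<Rightarrow> 'a"  (infixr \<open>*\<^sub>C\<close> 75)
    and cinner :: "'a \<Rightarrow> 'a \<Rightarrow> complex"
  assumes scaleC_add_right: "a *\<^sub>C (x + y) = a *\<^sub>C x + a *\<^sub>C y"
    and scaleC_add_left: "(a + b) *\<^sub>C x = a *\<^sub>C x + b *\<^sub>C x"
    and scaleC_scaleC: "a *\<^sub>C (b *\<^sub>C x) = (a * b) *\<^sub>C x"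
    and scaleC_one: "1 *\<^sub>C x = x"
    and scaleR_scaleC: "r *\<^sub>R x = complex_of_real r *\<^sub>C x"
    and cinner_commute: "cinner x y = cnj (cinner y x)"
    and cinner_add_left: "cinner (x + y) z = cinner x z + cinner y z"
    and cinner_scaleC_left: "cinner (a *\<^sub>C x) y = a * cinner x y"
    and norm_eq_sqrt_cinner: "norm x = sqrt (Re (cinner x x))"

global_interpretation complex_space:
  vector_space "scaleC :: complex \<Rightarrow> 'a \<Rightarrow> 'a::complex_hilbert"
  by unfold_locales
    (auto simp: scaleC_add_right scaleC_add_left scaleC_scaleC scaleC_one)

instantiation complex :: complex_hilbert
begin

definition scaleC_complex_def: "a *\<^sub>C (x::complex) = a * x"
definition cinner_complex_def: "cinner (x::complex) y = x * cnj y"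

instance
proof
  fix x :: complex
  show "norm x = sqrt (Re (cinner x x))"
    by (simp add: cinner_complex_def cmod_def power2_eq_square)
qed (auto simp: scaleC_complex_def cinner_complex_def algebra_simps scaleR_conv_of_real)

end

instantiation vec :: (complex_hilbert, finite) complex_hilbert
begin

definition scaleC_vec_def: "a *\<^sub>C (x::'a^'b) = (\<chi> i. a *\<^sub>C (x $ i))"
definition cinner_vec_def: "cinner (x::'a^'b) y = (\<Sum>i\<in>UNIV. cinner (x $ i) (y $ i))"

instance
proof
  fix x y z :: "'a^'b" and a b :: complex and r :: real
  show "a *\<^sub>C (x + y) = a *\<^sub>C x + a *\<^sub>C y"
    by (simp add: scaleC_vec_def vec_eq_iff scaleC_add_right)
  show "(a + b) *\<^sub>C x = a *\<^sub>C x + b *\<^sub>C x"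
    by (simp add: scaleC_vec_def vec_eq_iff scaleC_add_left)
  show "a *\<^sub>C (b *\<^sub>C x) = (a * b) *\<^sub>C x"
    by (simp add: scaleC_vec_def scaleC_scaleC)
  show "1 *\<^sub>C x = x"
    by (simp add: scaleC_vec_def scaleC_one)
  show "r *\<^sub>R x = complex_of_real r *\<^sub>C x"
    by (simp add: scaleC_vec_def vec_eq_iff scaleR_scaleC)
  show "cinner x y = cnj (cinner y x)"
    by (simp add: cinner_vec_def cnj_sum cinner_commute[symmetric])
  show "cinner (x + y) z = cinner x z + cinner y z"
    by (simp add: cinner_vec_def cinner_add_left sum.distrib)
  show "cinner (a *\<^sub>C x) y = a * cinner x y"
    by (simp add: cinner_vec_def scaleC_vec_def cinner_scaleC_left sum_distrib_left)
  have "(norm (x $ i))\<^sup>2 = Re (cinner (x $ i) (x $ i))" for i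
    by (metis norm_eq_sqrt_cinner norm_ge_zero real_sqrt_ge_0_iff real_sqrt_pow2)
  then show "norm x = sqrt (Re (cinner x x))"
    by (simp add: norm_vec_def L2_set_def cinner_vec_def)
qed

end

section \<open>Operators and matrices\<close>

definition bounded_clinear :: "('a::complex_hilbert \<Rightarrow> 'b::complex_hilbert) \<Rightarrow> bool"
  where "bounded_clinear A \<longleftrightarrow> bounded_linear A \<and> (\<forall>a x. A (a *\<^sub>C x) = a *\<^sub>C A x)"

definition cadjoint :: "('a::complex_hilbert \<Rightarrow> 'b::complex_hilbert) \<Rightarrow> 'b \<Rightarrow> 'a"
  where "cadjoint A = (SOME A'. \<forall>x y. cinner (A x) y = cinner x (A' y))"

definition unitary_op :: "('a::complex_hilbert \<Rightarrow> 'a) \<Rightarrow> bool"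
  where "unitary_op U \<longleftrightarrow>
    bounded_clinear U \<and> surj U \<and> (\<forall>x y. cinner (U x) (U y) = cinner x y)"

definition resolvent :: "('a::complex_hilbert \<Rightarrow> 'a) \<Rightarrow> complex \<Rightarrow> 'a \<Rightarrow> 'a"
  where "resolvent A l = inv (\<lambda>x. A x - l *\<^sub>C x)"

definition conj_transpose :: "complex^'n^'m \<Rightarrow> complex^'m^'n"
  where "conj_transpose A = (\<chi> i j. cnj (A $ j $ i))"

definition unitary_matrix :: "complex^'n^'n \<Rightarrow> bool"
  where "unitary_matrix A \<longleftrightarrow>
    conj_transpose A ** A = mat 1 \<and> A ** conj_transpose A = mat 1"

definition matrix_deriv :: "(complex \<Rightarrow> complex^'n^'m) \<Rightarrow> complex \<Rightarrow> complex^'n^'m"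
  where "matrix_deriv F l = (\<chi> i j. deriv (\<lambda>z. F z $ i $ j) l)"

section \<open>Trace of finite rank operators, determinant of identity plus finite rank\<close>

definition range_basis :: "('a::complex_hilbert \<Rightarrow> 'a) \<Rightarrow> 'a set"
  where "range_basis F =
    (SOME b. complex_space.independent b \<and> complex_space.span b = range F)"

text \<open>A finite rank operator \<open>F\<close> leaves its range invariant, and its trace is that of its
  restriction to the range. Likewise \<open>A = I + F\<close> leaves the range of \<open>F\<close> invariant and induces the
  identity on the quotient by it, so its determinant is that of its restriction to the range of
  \<open>F\<close>, given below by the Leibniz formula. Neither value depends on the chosen basis.\<close>

definition op_trace :: "('a::complex_hilbert \<Rightarrow> 'a) \<Rightarrow> complex"
  where "op_trace F =
    (let b = range_basis F in \<Sum>x\<in>b. complex_space.representation b (F x) x)"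

definition op_det :: "('a::complex_hilbert \<Rightarrow> 'a) \<Rightarrow> complex"
  where "op_det A =
    (let b = range_basis (\<lambda>x. A x - x) in
      \<Sum>p\<in>{p. p permutes b}. of_int (sign p) *
        (\<Prod>x\<in>b. complex_space.representation b (A x) (p x)))"

section \<open>The model and its Caratheodory function\<close>

definition model_of_pair ::
    "('h::complex_hilbert \<Rightarrow> 'h) \<Rightarrow> ('h \<Rightarrow> 'h) \<Rightarrow> complex^'n^'n \<Rightarrow> ('h \<Rightarrow> complex^'n) \<Rightarrow> bool"
  where "model_of_pair Up Um B C \<longleftrightarrow>
    bounded_clinear C \<and> unitary_matrix B \<and>
    (\<forall>x. x - cadjoint Up (Um x) = - cadjoint C (B *v C x)) \<and>
    matrix_inv B + conj_transpose (matrix_inv B) = - matrix (\<lambda>v. C (cadjoint C v))"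

definition caratheodory ::
    "('h::complex_hilbert \<Rightarrow> 'h) \<Rightarrow> complex^'n^'n \<Rightarrow> ('h \<Rightarrow> complex^'n) \<Rightarrow> complex \<Rightarrow> complex^'n^'n"
  where "caratheodory Up B C l =
    matrix_inv B +
    matrix (\<lambda>v. C (inv (\<lambda>x. x - l *\<^sub>C cadjoint Up x) (cadjoint C v)))"

end

theory Submission
  imports Defs
begin

text \<open>With \<open>R(z) = (I - z U\<^sub>+\<^sup>*)\<^sup>-\<^sup>1\<close> and \<open>P = R(\<lambda>) C\<^sup>* B\<close>, the model relation
  \<open>U\<^sub>- = U\<^sub>+ (I + C\<^sup>* B C)\<close> gives \<open>(U\<^sub>+ - \<lambda>)\<^sup>-\<^sup>1 (U\<^sub>- - \<lambda>) = I + P C\<close>, whereas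
  \<open>\<Phi>(\<lambda>) B = I + C P\<close>, so the determinant formula is Sylvester's identity
  \<open>det (I + P C) = det (I + C P)\<close>. Likewise the difference of the resolvents is
  \<open>P C (U\<^sub>- - \<lambda>)\<^sup>-\<^sup>1\<close>, whose trace is that of \<open>N = C (U\<^sub>- - \<lambda>)\<^sup>-\<^sup>1 P\<close>, and
  \<open>(I + C P) N = \<Phi>'(\<lambda>) B\<close> because \<open>\<Phi>'(\<lambda>) = C R(\<lambda>) U\<^sub>+\<^sup>* R(\<lambda>) C\<^sup>*\<close>. The dimension
  hypothesis makes the ranges involved exactly \<open>n\<close>-dimensional, so that the operators restricted
  to them are similar to \<open>n \<times> n\<close> matrices.\<close>

section \<open>Adjoints and resolvents of unitary operators\<close>

lemma cinner_add_right: "cinner x (y + z) = cinner x y + cinner x z"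
  by (metis cinner_add_left cinner_commute complex_cnj_add)

lemma cinner_scaleC_right: "cinner x (a *\<^sub>C y) = cnj a * cinner x y"
  by (metis cinner_scaleC_left cinner_commute complex_cnj_mult)

lemma cinner_minus_left: "cinner (- x) y = - cinner x y"
  using cinner_scaleC_left[of "-1" x y] by simp

lemma cinner_minus_right: "cinner x (- y) = - cinner x y"
  by (metis cinner_minus_left cinner_commute complex_cnj_minus)

lemma cinner_diff_left: "cinner (x - y) z = cinner x z - cinner y z"
  using cinner_add_left[of x "- y" z] by (simp add: cinner_minus_left)

lemma cinner_diff_right: "cinner x (y - z) = cinner x y - cinner x z"
  using cinner_add_right[of x y "- z"] by (simp add: cinner_minus_right)

lemma cinner_self: "cinner x x = complex_of_real ((norm x)\<^sup>2)"
proof -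
  have "Im (cinner x x) = 0"
    using arg_cong[OF cinner_commute[of x x], of Im] by simp
  moreover have "(norm x)\<^sup>2 = Re (cinner x x)"
    by (metis norm_eq_sqrt_cinner norm_ge_zero real_sqrt_ge_0_iff real_sqrt_pow2)
  ultimately show ?thesis
    by (simp add: complex_eq_iff)
qed

lemma norm_scaleC: "norm (a *\<^sub>C x) = cmod a * norm x"
proof -
  have "complex_of_real ((norm (a *\<^sub>C x))\<^sup>2) = of_real ((cmod a * norm x)\<^sup>2)"
    unfolding cinner_self[symmetric] cinner_scaleC_left cinner_scaleC_right
    using complex_norm_square[of a, symmetric]
    by (simp add: cinner_self power_mult_distrib mult.assoc[symmetric] mult.commute[of "cnj a"])
  then have "(norm (a *\<^sub>C x))\<^sup>2 = (cmod a * norm x)\<^sup>2"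
    using of_real_eq_iff by blast
  then show ?thesis
    by (simp add: power2_eq_iff_nonneg)
qed

lemma norm_add_square: "(norm (x + y))\<^sup>2 = (norm x)\<^sup>2 + (norm y)\<^sup>2 + 2 * Re (cinner x y)"
proof -
  have *: "(norm z)\<^sup>2 = Re (cinner z z)" for z :: 'a
    by (simp add: cinner_self)
  show ?thesis
    using arg_cong[OF cinner_commute[of x y], of Re]
    by (simp add: * cinner_add_left cinner_add_right)
qed

lemma parallelogram_law:
  fixes x y :: "'a::complex_hilbert"
  shows "(norm (x + y))\<^sup>2 + (norm (x - y))\<^sup>2 = 2 * (norm x)\<^sup>2 + 2 * (norm y)\<^sup>2"
  using norm_add_square[of x y] norm_add_square[of x "- y"] by (simp add: cinner_minus_right)

lemma cinner_ext:
  assumes "\<And>z. cinner z x = cinner z y"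
  shows "x = y"
  using assms[of "x - y"] cinner_self[of "x - y"] by (simp add: cinner_diff_right)

text \<open>Pythagoras for removing from \<open>x\<close> its component along \<open>z\<close>.
  Nonnegativity of the left-hand side yields Cauchy-Schwarz, and the explicit decrease yields
  orthogonality of norm-minimal vectors.\<close>

lemma norm_diff_projection:
  fixes x z :: "'a::complex_hilbert"
  assumes "z \<noteq> 0"
  shows "(norm (x - (cinner x z / of_real ((norm z)\<^sup>2)) *\<^sub>C z))\<^sup>2 =
    (norm x)\<^sup>2 - (cmod (cinner x z) / norm z)\<^sup>2"
proof -
  define c where "c = cinner x z"
  define a where "a = - (c / of_real ((norm z)\<^sup>2))"
  have "cinner x (a *\<^sub>C z) = - (c * cnj c / of_real ((norm z)\<^sup>2))"
    by (simp add: a_def cinner_scaleC_right c_def[symmetric] del: complex_space.scale_minus_left)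
  then have "Re (cinner x (a *\<^sub>C z)) = - ((cmod c)\<^sup>2 / (norm z)\<^sup>2)"
    unfolding complex_norm_square[symmetric]
    by (simp only: of_real_divide[symmetric] uminus_complex.sel Re_complex_of_real)
  moreover have "(norm (a *\<^sub>C z))\<^sup>2 = (cmod c)\<^sup>2 / (norm z)\<^sup>2"
    using assms by (simp add: norm_scaleC a_def norm_divide norm_mult power2_eq_square)
  ultimately have "(norm (x + a *\<^sub>C z))\<^sup>2 = (norm x)\<^sup>2 - (cmod c / norm z)\<^sup>2"
    by (simp add: norm_add_square power_divide)
  then show ?thesis
    by (simp add: a_def c_def)
qed

lemma cinner_Cauchy_Schwarz: "cmod (cinner x z) \<le> norm x * norm z"
proof (cases "z = 0")
  case True
  then show ?thesis
    using cinner_scaleC_right[of x 0 0] by simp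
next
  case False
  have "(cmod (cinner x z) / norm z)\<^sup>2 \<le> (norm x)\<^sup>2"
    using norm_diff_projection[OF False, of x] by (metis diff_ge_0_iff_ge zero_le_power2)
  then have "cmod (cinner x z) / norm z \<le> norm x"
    by (rule power2_le_imp_le) simp
  then show ?thesis
    using False by (simp add: field_simps)
qed

section \<open>Minimal norms, Riesz representation and existence of adjoints\<close>

lemma cinner_eq_zero_if_norm_minimal:
  assumes "\<And>a. norm x \<le> norm (x - a *\<^sub>C z)"
  shows "cinner z x = 0"
proof (cases "z = 0")
  case True
  then show ?thesis
    using cinner_scaleC_left[of 0 0 x] by simp
next
  case False
  \<comment> \<open>Here \<open>a\<close> is the projection coefficient of \<open>x\<close> on
    \<open>z\<close>; minimality forces the subtracted square to vanish.\<close>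
  have "(norm x)\<^sup>2 \<le> (norm x)\<^sup>2 - (cmod (cinner x z) / norm z)\<^sup>2"
    unfolding norm_diff_projection[OF False, symmetric] by (intro power_mono assms) simp
  then have "cinner x z = 0"
    using False by simp
  then show ?thesis
    by (metis cinner_commute complex_cnj_zero)
qed

text \<open>A sequence in \<open>S\<close> whose norms tend to the infimum \<open>d\<close> is
  Cauchy: midpoints stay in \<open>S\<close>, so their norm is at least \<open>d\<close>, and the
  parallelogram law then bounds the distances.\<close>

lemma convex_complete_minimal_norm:
  fixes S :: "'a::complex_hilbert set"
  assumes "closed S" "convex S" "S \<noteq> {}"
  obtains x where "x \<in> S" "\<And>y. y \<in> S \<Longrightarrow> norm x \<le> norm y"
proof -
  define d where "d = Inf (norm ` S)"
  have bdd: "bdd_below (norm ` S)"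
    by (auto intro: bdd_belowI[of _ 0])
  have d_le: "d \<le> norm y" if "y \<in> S" for y
    unfolding d_def using that bdd by (auto intro: cInf_lower)
  have d0: "0 \<le> d"
    unfolding d_def using assms(3) by (intro cInf_greatest) auto
  have "\<exists>y\<in>S. norm y < d + inverse (real (Suc k))" for k
    using cInf_lessD[of "norm ` S" "d + inverse (real (Suc k))"] assms(3) by (auto simp: d_def)
  then obtain s where s: "\<And>k. s k \<in> S" "\<And>k. norm (s k) < d + inverse (real (Suc k))"
    by metis
  have lim: "(\<lambda>k. norm (s k)) \<longlonglongrightarrow> d"
  proof (rule tendsto_sandwich[where f = "\<lambda>_. d"])
    show "(\<lambda>k. d + inverse (real (Suc k))) \<longlonglongrightarrow> d"
      using tendsto_add[OF tendsto_const LIMSEQ_inverse_real_of_nat, of d] by simp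
    show "(\<lambda>k. d) \<longlonglongrightarrow> d"
      by simp
    show "\<forall>\<^sub>F k in sequentially. d \<le> norm (s k)"
      using d_le[OF s(1)] by simp
    show "\<forall>\<^sub>F k in sequentially. norm (s k) \<le> d + inverse (real (Suc k))"
      using s(2) by (intro always_eventually allI less_imp_le)
  qed
  have mid: "(norm (y - z))\<^sup>2 \<le> 2 * (norm y)\<^sup>2 + 2 * (norm z)\<^sup>2 - 4 * d\<^sup>2" if "y \<in> S" "z \<in> S" for y z
  proof -
    have "(1/2) *\<^sub>R y + (1/2) *\<^sub>R z \<in> S"
      using assms(2) that by (auto intro: convexD)
    then have "d \<le> norm ((1/2) *\<^sub>R (y + z))"
      using d_le by (simp add: scaleR_add_right)
    then have "2 * d \<le> norm (y + z)"
      by simp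
    then have "(2 * d)\<^sup>2 \<le> (norm (y + z))\<^sup>2"
      using d0 by (intro power_mono) auto
    then show ?thesis
      using parallelogram_law[of y z] by simp
  qed
  have "Cauchy s"
  proof (rule CauchyI)
    fix e :: real
    assume "0 < e"
    \<comment> \<open>The slack \<open>e\<^sup>2 / 4\<close> is what \<open>mid\<close> turns into
      exactly \<open>e\<^sup>2\<close>: two terms, each with factor 2, and the multiples of
      \<open>d\<^sup>2\<close> cancel.\<close>
    have "(\<lambda>k. (norm (s k))\<^sup>2) \<longlonglongrightarrow> d\<^sup>2"
      by (intro tendsto_power lim)
    then have "\<forall>\<^sub>F k in sequentially. (norm (s k))\<^sup>2 < d\<^sup>2 + e\<^sup>2 / 4"
      using \<open>0 < e\<close> by (auto intro!: order_tendstoD)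
    then obtain M where M: "\<And>k. k \<ge> M \<Longrightarrow> (norm (s k))\<^sup>2 < d\<^sup>2 + e\<^sup>2 / 4"
      by (auto simp: eventually_sequentially)
    have "norm (s m - s n) < e" if "m \<ge> M" "n \<ge> M" for m n
    proof -
      have "(norm (s m - s n))\<^sup>2 < e\<^sup>2"
        using mid[OF s(1) s(1), of m n] M[OF that(1)] M[OF that(2)] by simp
      then show ?thesis
        by (rule power2_less_imp_less) (use \<open>0 < e\<close> in simp)
    qed
    then show "\<exists>M. \<forall>m\<ge>M. \<forall>n\<ge>M. norm (s m - s n) < e"
      by blast
  qed
  then obtain x where x: "s \<longlonglongrightarrow> x"
    by (auto simp: Cauchy_convergent_iff convergent_def)
  have "norm x = d"
    using LIMSEQ_unique[OF tendsto_norm[OF x] lim] .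
  moreover have "x \<in> S"
    using closed_sequentially[OF assms(1) _ x] s(1) by blast
  ultimately show thesis
    using that d_le by blast
qed

lemma bounded_clinearD:
  assumes "bounded_clinear A"
  shows "bounded_linear A" "A (x + y) = A x + A y" "A (x - y) = A x - A y" "A (- x) = - A x"
    "A 0 = 0" "A (a *\<^sub>C x) = a *\<^sub>C A x"
proof -
  from assms have bl: "bounded_linear A" and sc: "\<And>a x. A (a *\<^sub>C x) = a *\<^sub>C A x"
    by (auto simp: bounded_clinear_def)
  then interpret bounded_linear A
    by blast
  show "bounded_linear A" "A (x + y) = A x + A y" "A (x - y) = A x - A y" "A (- x) = - A x"
    "A 0 = 0" "A (a *\<^sub>C x) = a *\<^sub>C A x"
    by (fact bl add diff neg zero sc)+
qed

text \<open>For nonzero \<open>f\<close>, the element \<open>u\<close> of least norm on the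
  hyperplane \<open>f x = 1\<close> is orthogonal to the kernel of \<open>f\<close>. Since
  \<open>x - f x *\<^sub>C u\<close> lies in that kernel, a rescaling of \<open>u\<close> represents
  \<open>f\<close>.\<close>

lemma riesz_representation:
  fixes f :: "'a::complex_hilbert \<Rightarrow> complex"
  assumes f: "bounded_clinear f"
  obtains y where "\<And>x. f x = cinner x y"
proof (cases "\<forall>x. f x = 0")
  case True
  then have "f x = cinner x 0" for x
    using cinner_scaleC_right[of x 0 0] by simp
  then show thesis
    by (rule that)
next
  case False
  then obtain x0 where "f x0 \<noteq> 0"
    by blast
  then have "f (inverse (f x0) *\<^sub>C x0) = 1"
    by (simp add: bounded_clinearD[OF f] scaleC_complex_def)
  then have ne: "{x. f x = 1} \<noteq> {}"
    by blast
  have "closed (f -` {1})"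
    using bounded_clinearD(1)[OF f]
    by (intro continuous_closed_vimage) (auto simp: linear_continuous_at)
  then have closed: "closed {x. f x = 1}"
    by (simp add: vimage_def)
  have conv: "convex {x. f x = 1}"
    unfolding convex_def
    by (auto simp: bounded_clinearD[OF f] scaleR_scaleC scaleC_complex_def simp flip: of_real_add)
  obtain u where u: "f u = 1" "\<And>y. f y = 1 \<Longrightarrow> norm u \<le> norm y"
    using convex_complete_minimal_norm[OF closed conv ne] by auto
  have orth: "cinner z u = 0" if "f z = 0" for z
    by (rule cinner_eq_zero_if_norm_minimal) (use u that in \<open>simp add: bounded_clinearD[OF f] scaleC_complex_def\<close>)
  have "u \<noteq> 0"
    using u(1) bounded_clinearD(5)[OF f] by auto
  have "f x = cinner x (of_real (1 / (norm u)\<^sup>2) *\<^sub>C u)" for x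
  proof -
    have "cinner (x - f x *\<^sub>C u) u = 0"
      by (rule orth) (simp add: bounded_clinearD[OF f] u scaleC_complex_def)
    then have "cinner x u = f x * of_real ((norm u)\<^sup>2)"
      by (simp add: cinner_diff_left cinner_scaleC_left cinner_self)
    then show ?thesis
      using \<open>u \<noteq> 0\<close> by (simp add: cinner_scaleC_right)
  qed
  then show thesis
    using that by blast
qed

text \<open>Riesz representation of \<open>\<lambda>x. cinner (A x) y\<close> supplies, for each
  \<open>y\<close>, the witness that the choice in \<open>cadjoint\<close> requires.\<close>

lemma cinner_cadjoint:
  fixes A :: "'a::complex_hilbert \<Rightarrow> 'b::complex_hilbert"
  assumes A: "bounded_clinear A"
  shows "cinner (A x) y = cinner x (cadjoint A y)"
proof -
  have "\<exists>z. \<forall>x. cinner (A x) y = cinner x z" for y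
  proof -
    have "bounded_linear (\<lambda>w. cinner w y)"
    proof (rule bounded_linear_intro[of _ "norm y"])
      show "norm (cinner w y) \<le> norm w * norm y" for w
        by (rule cinner_Cauchy_Schwarz)
    qed (simp_all add: cinner_add_left cinner_scaleC_left scaleR_scaleC scaleC_complex_def)
    then have "bounded_clinear (\<lambda>x. cinner (A x) y)"
      using bounded_linear_compose[of "\<lambda>w. cinner w y" A] bounded_clinearD[OF A]
      by (simp add: bounded_clinear_def cinner_scaleC_left scaleC_complex_def)
    then show ?thesis
      by (meson riesz_representation)
  qed
  then have "\<exists>A'. \<forall>x y. cinner (A x) y = cinner x (A' y)"
    by metis
  then have "\<forall>x y. cinner (A x) y = cinner x (cadjoint A y)"
    unfolding cadjoint_def by (rule someI_ex)
  then show ?thesis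
    by blast
qed

section \<open>Complex-linear maps and their matrices\<close>

abbreviation clinear :: "('a::complex_hilbert \<Rightarrow> 'b::complex_hilbert) \<Rightarrow> bool"
  where "clinear \<equiv> Vector_Spaces.linear (*\<^sub>C) (*\<^sub>C)"

lemma clinear_iff: "clinear f \<longleftrightarrow> (\<forall>x y. f (x + y) = f x + f y) \<and> (\<forall>a x. f (a *\<^sub>C x) = a *\<^sub>C f x)"
  by (simp add: Vector_Spaces.linear_iff complex_space.vector_space_axioms)

lemma clinear_add: "clinear f \<Longrightarrow> f (x + y) = f x + f y"
  and clinear_scaleC: "clinear f \<Longrightarrow> f (a *\<^sub>C x) = a *\<^sub>C f x"
  by (simp_all add: clinear_iff)

lemma clinear_compose: "clinear f \<Longrightarrow> clinear g \<Longrightarrow> clinear (\<lambda>x. g (f x))"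
  by (simp add: clinear_iff)

lemma clinear_sum: "clinear f \<Longrightarrow> f (sum g S) = (\<Sum>i\<in>S. f (g i))"
  by (rule module_hom.sum) (erule module_hom_linearI)

lemma bounded_clinear_clinear: "bounded_clinear f \<Longrightarrow> clinear f"
  by (simp add: clinear_iff bounded_clinearD)

lemma clinear_cadjoint:
  assumes "bounded_clinear A"
  shows "clinear (cadjoint A)"
  unfolding clinear_iff
  by (intro conjI allI; rule cinner_ext)
    (simp_all add: cinner_cadjoint[OF assms, symmetric] cinner_add_right cinner_scaleC_right)

text \<open>Lets matrix facts phrased with \<open>*s\<close> be applied to \<open>clinear\<close>
  maps.\<close>

lemma scaleC_eq_scalar_mult: "(*\<^sub>C) = ((*s) :: complex \<Rightarrow> complex^'n \<Rightarrow> complex^'n)"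
  by (simp add: fun_eq_iff vec_eq_iff scaleC_vec_def scaleC_complex_def)

lemma clinear_matrix_vector_mult: "clinear ((*v) (A :: complex^'n^'m))"
  by (simp add: scaleC_eq_scalar_mult matrix_vector_mul_linear_gen)

lemma clinear_matrix_works:
  fixes f :: "complex^'n \<Rightarrow> complex^'m"
  shows "clinear f \<Longrightarrow> matrix f *v x = f x"
  by (simp add: scaleC_eq_scalar_mult matrix_works)

section \<open>Unitary operators, their resolvents and differentiation in the spectral
  parameter\<close>

lemma unitary_op_cadjoint:
  assumes "unitary_op U"
  shows "cadjoint U (U x) = x" "U (cadjoint U x) = x"
proof -
  have *: "cadjoint U (U x) = x" for x
  proof (rule cinner_ext)
    show "cinner z (cadjoint U (U x)) = cinner z x" for z
      using assms by (simp add: unitary_op_def flip: cinner_cadjoint)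
  qed
  show "cadjoint U (U x) = x"
    by (rule *)
  obtain y where "x = U y"
    using assms by (metis unitary_op_def surjD)
  then show "U (cadjoint U x) = x"
    by (simp add: *)
qed

lemma unitary_op_norm:
  assumes "unitary_op U"
  shows "norm (U x) = norm x" "norm (cadjoint U x) = norm x"
proof -
  have *: "norm (U x) = norm x" for x
    using assms by (simp add: unitary_op_def norm_eq_sqrt_cinner)
  show "norm (U x) = norm x" "norm (cadjoint U x) = norm x"
    using *[of x] *[of "cadjoint U x"] unitary_op_cadjoint(2)[OF assms] by simp_all
qed

text \<open>Solving \<open>x - a *\<^sub>C V x = y\<close> means finding a fixed point of
  \<open>\<lambda>x. y + a *\<^sub>C V x\<close>, a contraction with constant
  \<open>cmod a\<close>.\<close>

lemma bij_diff_small_isometry: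
  fixes V :: "'a::complex_hilbert \<Rightarrow> 'a"
  assumes V: "clinear V" "\<And>x. norm (V x) = norm x" and "cmod a < 1"
  shows "bij (\<lambda>x. x - a *\<^sub>C V x)"
  unfolding bij_iff
proof
  fix y
  have diff: "V u - V v = V (u - v)" for u v
    using clinear_add[OF V(1), of "u - v" v] by simp
  have "\<exists>!x. y + a *\<^sub>C V x = x"
  proof (rule banach_fix_type[of "cmod a"])
    show "\<forall>u v. dist (y + a *\<^sub>C V u) (y + a *\<^sub>C V v) \<le> cmod a * dist u v"
      by (simp add: dist_norm norm_scaleC V(2) diff flip: complex_space.scale_right_diff_distrib)
  qed (use assms in auto)
  then show "\<exists>!x. x - a *\<^sub>C V x = y"
    by (metis diff_eq_eq)
qed

text \<open>Both maps reduce to a small perturbation of the identity. Inside the disk,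
  \<open>U - l\<close> is \<open>I - l V\<close> after \<open>U\<close>, with \<open>V\<close> the
  adjoint; outside, it is \<open>- l\<close> times \<open>I - inverse l U\<close>. The second map is
  the first one after \<open>V\<close>.\<close>

lemma bij_diff_unitary:
  assumes U: "unitary_op U" and "l \<in> - sphere 0 1"
  shows "bij (\<lambda>x. U x - l *\<^sub>C x)" "bij (\<lambda>x. x - l *\<^sub>C cadjoint U x)"
proof -
  let ?V = "cadjoint U"
  note UV = unitary_op_cadjoint[OF U] and nrm = unitary_op_norm[OF U]
  have lin: "clinear U" "clinear ?V"
    using U by (simp_all add: unitary_op_def bounded_clinear_clinear clinear_cadjoint)
  have bijU: "bij U"
    using UV by (metis bijI')
  have bijV: "bij ?V"
    using UV by (metis bijI')
  have comp: "(\<lambda>x. x - l *\<^sub>C ?V x) = (\<lambda>x. U x - l *\<^sub>C x) \<circ> ?V"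
    by (simp add: fun_eq_iff UV)
  have "bij (\<lambda>x. U x - l *\<^sub>C x)"
  proof (cases "cmod l < 1")
    case True
    have "(\<lambda>x. U x - l *\<^sub>C x) = (\<lambda>x. x - l *\<^sub>C ?V x) \<circ> U"
      by (simp add: fun_eq_iff UV)
    then show ?thesis
      using bij_comp[OF bijU bij_diff_small_isometry[OF lin(2) nrm(2) True]] by simp
  next
    case False
    then have l: "cmod (inverse l) < 1" "l \<noteq> 0"
      using assms(2) by (auto simp: norm_inverse inverse_less_1_iff)
    have "bij (\<lambda>x. - l *\<^sub>C x :: 'a)"
      by (rule bij_betw_byWitness[where f' = "\<lambda>x. - inverse l *\<^sub>C x"]) (use l in auto)
    moreover have "(\<lambda>x. U x - l *\<^sub>C x) = (\<lambda>x. - l *\<^sub>C x) \<circ> (\<lambda>x. x - inverse l *\<^sub>C U x)"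
      using l by (simp add: fun_eq_iff complex_space.scale_right_diff_distrib)
    ultimately show ?thesis
      using bij_comp[OF bij_diff_small_isometry[OF lin(1) nrm(1) l(1)]] by simp
  qed
  then show "bij (\<lambda>x. U x - l *\<^sub>C x)" "bij (\<lambda>x. x - l *\<^sub>C ?V x)"
    unfolding comp using bij_comp[OF bijV] by auto
qed

lemma clinear_inv:
  assumes "clinear f" "bij f"
  shows "clinear (inv f)"
proof -
  have f: "f (inv f x) = x" for x
    using assms(2) by (simp add: bij_is_surj surj_f_inv_f)
  have inv: "inv f x = y" if "f y = x" for x y
    using bij_inv_eq_iff[OF assms(2)] that by metis
  show ?thesis
    unfolding clinear_iff
    by (intro conjI allI inv) (simp_all add: f clinear_add[OF assms(1)] clinear_scaleC[OF assms(1)])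
qed

text \<open>As \<open>cadjoint U\<close> is isometric, the two terms of
  \<open>x - l *\<^sub>C cadjoint U x\<close> have norms \<open>norm x\<close> and
  \<open>cmod l * norm x\<close>, and the reverse triangle inequality applies.\<close>

lemma norm_inv_diff_unitary_le:
  assumes U: "unitary_op U" and l: "l \<in> - sphere 0 1"
  shows "norm (inv (\<lambda>x. x - l *\<^sub>C cadjoint U x) y) \<le> norm y / \<bar>1 - cmod l\<bar>"
proof -
  define x where "x = inv (\<lambda>x. x - l *\<^sub>C cadjoint U x) y"
  have y: "y = x - l *\<^sub>C cadjoint U x"
    using bij_inv_eq_iff[OF bij_diff_unitary(2)[OF U l], of x y] by (simp add: x_def)
  have "norm (l *\<^sub>C cadjoint U x) = cmod l * norm x"
    by (simp add: norm_scaleC unitary_op_norm[OF U])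
  then have "\<bar>1 - cmod l\<bar> * norm x \<le> norm y"
    using norm_triangle_ineq3[of x "l *\<^sub>C cadjoint U x"]
    by (simp add: y left_diff_distrib abs_mult_pos)
  moreover have "\<bar>1 - cmod l\<bar> > 0"
    using l by auto
  ultimately show ?thesis
    by (simp add: x_def[symmetric] field_simps)
qed

text \<open>By the resolvent identity the difference quotient equals
  \<open>g (R z (cadjoint U (R l w)))\<close>, so only continuity of
  \<open>z \<mapsto> R z u\<close> at \<open>l\<close> is needed. That follows from the same
  identity and the norm bound. The functional \<open>g\<close> reduces everything to scalar
  derivatives; it will be a coordinate of \<open>C\<close>.\<close>

lemma DERIV_inv_diff_unitary:
  fixes g :: "'h::complex_hilbert \<Rightarrow> complex"
  assumes U: "unitary_op U" and l: "l \<in> - sphere 0 1" and g: "bounded_clinear g"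
  defines "R \<equiv> \<lambda>z. inv (\<lambda>x. x - z *\<^sub>C cadjoint U x)"
  shows "((\<lambda>z. g (R z w)) has_field_derivative g (R l (cadjoint U (R l w)))) (at l)"
proof -
  let ?V = "cadjoint U"
  have V: "clinear ?V"
    using U by (simp add: unitary_op_def clinear_cadjoint)
  have R: "R z x - z *\<^sub>C ?V (R z x) = x" if "z \<in> - sphere 0 1" for z x
    using surj_f_inv_f[OF bij_is_surj[OF bij_diff_unitary(2)[OF U that]]] by (simp add: R_def)
  have R_eqI: "R z x = y" if "y - z *\<^sub>C ?V y = x" "z \<in> - sphere 0 1" for x y z
    using inv_f_f[OF bij_is_inj[OF bij_diff_unitary(2)[OF U that(2)]], of y] that(1) by (simp add: R_def)
  have norm_R: "norm (R z x) \<le> norm x / \<bar>1 - cmod z\<bar>" if "z \<in> - sphere 0 1" for z x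
    unfolding R_def by (rule norm_inv_diff_unitary_le[OF U that])
  have resolvent_identity: "R z w - R l w = (z - l) *\<^sub>C R z (?V (R l w))" if z: "z \<in> - sphere 0 1" for z w
  proof -
    define u where "u = R z (?V (R l w))"
    have "R z w = R l w + (z - l) *\<^sub>C u"
    \<comment> \<open>By uniqueness it suffices that the proposed vector solves the equation
      defining \<open>R z w\<close>.\<close>
    proof (rule R_eqI[OF _ z])
      have V_add: "?V (R l w + (z - l) *\<^sub>C u) = ?V (R l w) + (z - l) *\<^sub>C ?V u"
        by (simp add: clinear_add[OF V] clinear_scaleC[OF V])
      have "R l w + (z - l) *\<^sub>C u - z *\<^sub>C ?V (R l w + (z - l) *\<^sub>C u) =
          (R l w - l *\<^sub>C ?V (R l w)) + (z - l) *\<^sub>C (u - z *\<^sub>C ?V u) - (z - l) *\<^sub>C ?V (R l w)"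
        unfolding V_add
        by (simp add: complex_space.scale_right_distrib
            complex_space.scale_right_diff_distrib complex_space.scale_left_diff_distrib algebra_simps)
      then show "R l w + (z - l) *\<^sub>C u - z *\<^sub>C ?V (R l w + (z - l) *\<^sub>C u) = w"
        using R[OF l] R[OF z] by (simp add: u_def)
    qed
    then show ?thesis
      by (simp add: u_def)
  qed
  have near: "\<forall>\<^sub>F z in at l. z \<in> - sphere 0 1"
    using l by (intro eventually_at_topological[THEN iffD2]) (auto intro!: exI[of _ "- sphere 0 1"])
  have cont: "((\<lambda>z. R z u) \<longlongrightarrow> R l u) (at l)" for u
  proof (subst LIM_zero_iff[symmetric], rule Lim_null_comparison)
    let ?c = "norm (?V (R l u))"
    show "\<forall>\<^sub>F z in at l. norm (R z u - R l u) \<le> cmod (z - l) * (?c / \<bar>1 - cmod z\<bar>)"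
      using near
    proof eventually_elim
      case (elim z)
      then show ?case
        using norm_R[OF elim, of "?V (R l u)"]
        by (simp add: resolvent_identity[OF elim] norm_scaleC mult_left_mono del: times_divide_eq_right)
    qed
    have "((\<lambda>z. cmod (z - l) * (?c / \<bar>1 - cmod z\<bar>)) \<longlongrightarrow> cmod (l - l) * (?c / \<bar>1 - cmod l\<bar>)) (at l)"
      using l by (intro tendsto_intros) auto
    then show "((\<lambda>z. cmod (z - l) * (?c / \<bar>1 - cmod z\<bar>)) \<longlongrightarrow> 0) (at l)"
      by simp
  qed
  have "((\<lambda>z. g (R z (?V (R l w)))) \<longlongrightarrow> g (R l (?V (R l w)))) (at l)"
    by (rule bounded_linear.tendsto[OF bounded_clinearD(1)[OF g] cont])
  moreover have "\<forall>\<^sub>F z in at l. g (R z (?V (R l w))) = (g (R z w) - g (R l w)) / (z - l)"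
    using near eventually_neq_at_within[of l]
  proof eventually_elim
    case (elim z)
    then show ?case
      by (simp add: resolvent_identity bounded_clinearD[OF g] scaleC_complex_def flip: bounded_clinearD(3)[OF g])
  qed
  ultimately show ?thesis
    unfolding has_field_derivative_iff by (rule Lim_transform_eventually)
qed

section \<open>Trace and determinant of a product through a finite-dimensional space\<close>

lemma matrix_add_rdistrib: "(A + B) ** C = A ** C + B ** (C :: 'a::semiring_1^'n^'m)"
  by (simp add: matrix_matrix_mult_def vec_eq_iff distrib_right sum.distrib)

lemma matrix_inv_mult:
  fixes A :: "'a::semiring_1^'n^'m"
  assumes "invertible A"
  shows "A ** matrix_inv A = mat 1" "matrix_inv A ** A = mat 1"
  using someI_ex[OF assms[unfolded invertible_def]] by (simp_all add: matrix_inv_def)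

lemma trace_similar:
  fixes A Y :: "'a::comm_semiring_1^'n^'n"
  assumes "invertible Y"
  shows "trace (matrix_inv Y ** A ** Y) = trace A"
  by (simp add: trace_mul_sym[of "matrix_inv Y ** A"] matrix_mul_assoc matrix_inv_mult[OF assms])

lemma det_similar:
  fixes A Y :: "'a::comm_ring_1^'n^'n"
  assumes "invertible Y"
  shows "det (matrix_inv Y ** A ** Y) = det A"
proof -
  have "det (matrix_inv Y) * det Y = 1"
    by (simp add: matrix_inv_mult[OF assms] flip: det_mul)
  moreover have "det (matrix_inv Y ** A ** Y) = det A * (det (matrix_inv Y) * det Y)"
    by (simp add: det_mul mult_ac)
  ultimately show ?thesis
    by simp
qed

text \<open>Justifies the choice in \<open>range_basis\<close>: the range is a subspace and so has a
  basis.\<close>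

lemma range_basis:
  fixes F :: "'h::complex_hilbert \<Rightarrow> 'h"
  assumes "clinear F"
  shows "complex_space.independent (range_basis F)" "complex_space.span (range_basis F) = range F"
proof -
  have "complex_space.subspace (range F)"
    unfolding complex_space.subspace_def
  proof safe
    show "0 \<in> range F"
      using clinear_scaleC[OF assms, of 0 0] by (metis complex_space.scale_zero_left rangeI)
  qed (auto simp: clinear_add[OF assms, symmetric] clinear_scaleC[OF assms, symmetric])
  then have "\<exists>b. complex_space.independent b \<and> complex_space.span b = range F"
    by (metis complex_space.basis_exists complex_space.span_eq_iff complex_space.span_mono subset_antisym)
  from someI_ex[OF this]
  show "complex_space.independent (range_basis F)" "complex_space.span (range_basis F) = range F"
    by (auto simp: range_basis_def)
qed

text \<open>If \<open>P u\<^sub>j\<close> runs through a basis of the range of \<open>P Q\<close>, the vectors \<open>u\<^sub>j\<close> form a basis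
  of \<open>\<complex>\<^sup>n\<close> and \<open>P\<close> intertwines \<open>Q P\<close> with \<open>P Q\<close>.\<close>

lemma range_basis_representation:
  fixes P :: "complex^'n \<Rightarrow> 'h::complex_hilbert" and Q :: "'h \<Rightarrow> complex^'n"
  assumes P: "clinear P" and Q: "clinear Q"
    and dim: "complex_space.dim (range (\<lambda>x. P (Q x))) = CARD('n)"
  defines "b \<equiv> range_basis (\<lambda>x. P (Q x))"
  obtains e :: "'n \<Rightarrow> 'h" and Y :: "complex^'n^'n"
  where "bij_betw e UNIV b" "invertible Y"
    "\<forall>i j. complex_space.representation b (P (Q (e j))) (e i) =
      (matrix_inv Y ** matrix (\<lambda>v. Q (P v)) ** Y) $ i $ j"
proof -
  have ind: "complex_space.independent b" and span: "complex_space.span b = range (\<lambda>x. P (Q x))"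
    unfolding b_def by (intro range_basis clinear_compose[OF Q P])+
  have "card b = CARD('n)"
    using dim complex_space.dim_span_eq_card_independent[OF ind] by (simp add: span)
  then have "finite b"
    \<comment> \<open>An infinite \<open>b\<close> would have \<open>card b = 0\<close>, whereas
      \<open>CARD('n)\<close> is positive.\<close>
    by (metis card.infinite zero_less_card_finite less_not_refl)
  then obtain e :: "'n \<Rightarrow> 'h" where e: "bij_betw e UNIV b"
    using \<open>card b = CARD('n)\<close> by (metis bij_betw_iff_card finite_class.finite_UNIV)
  have "\<exists>h. P (Q h) = e j" for j
  proof -
    have "e j \<in> complex_space.span b"
      using e by (intro complex_space.span_base) (auto simp: bij_betw_def)
    then show ?thesis
      by (auto simp: span)
  qed
  then obtain h where h: "\<And>j. P (Q (h j)) = e j"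
    by metis
  \<comment> \<open>The columns of \<open>Y\<close> are vectors \<open>Q (h j)\<close> that
    \<open>P\<close> sends to the basis vectors \<open>e j\<close>.\<close>
  define Y :: "complex^'n^'n" where "Y = (\<chi> i j. Q (h j) $ i)"
  let ?N = "matrix (\<lambda>v. Q (P v))"
  define Z where "Z = matrix_inv Y ** ?N ** Y"
  have col: "column j Y = Q (h j)" for j
    by (simp add: Y_def column_def vec_eq_iff)
  have P_sum: "P (\<Sum>i\<in>UNIV. c i *s Q (h i)) = (\<Sum>i\<in>UNIV. c i *\<^sub>C e i)" for c
    by (simp add: clinear_sum[OF P] clinear_scaleC[OF P] h flip: scaleC_eq_scalar_mult)
  have sum_e: "(\<Sum>i\<in>UNIV. c i *\<^sub>C e i) = (\<Sum>x\<in>b. c (inv_into UNIV e x) *\<^sub>C x)" for c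
    using e by (subst sum.reindex_bij_betw[OF e, symmetric]) (simp add: bij_betw_def inv_into_f_f)
  \<comment> \<open>\<open>P\<close> carries a linear relation between the columns of
    \<open>Y\<close> to one between the \<open>e i\<close>, which are independent.\<close>
  have "c i = 0" if "(\<Sum>i\<in>UNIV. c i *s column i Y) = 0" for c i
  proof -
    have "(\<Sum>x\<in>b. c (inv_into UNIV e x) *\<^sub>C x) = 0"
      using P_sum[of c] that clinear_scaleC[OF P, of 0 0] by (simp add: col sum_e)
    then have "c (inv_into UNIV e (e i)) = 0"
      using complex_space.independentD[OF ind \<open>finite b\<close> order.refl, of "\<lambda>x. c (inv_into UNIV e x)" "e i"]
        e by (auto simp: bij_betw_def)
    then show ?thesis
      using e by (simp add: bij_betw_def inv_into_f_f)
  qed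
  then have Y: "invertible Y"
    using matrix_left_invertible_independent_columns[of Y] invertible_left_inverse by blast
  have "complex_space.representation b (P (Q (e j))) (e i) = Z $ i $ j" for i j
  proof -
    \<comment> \<open>Column by column, this expands \<open>Q (P (Q (h j)))\<close> in the vectors
      \<open>Q (h i)\<close> with coefficients from column \<open>j\<close> of \<open>Z\<close>.
      Applying \<open>P\<close> gives the expansion of \<open>P (Q (e j))\<close> in the
      basis.\<close>
    have "Y ** Z = ?N ** Y"
      by (simp add: Z_def matrix_mul_assoc matrix_inv_mult[OF Y])
    moreover have "column j (Y ** Z) = Y *v column j Z" "column j (?N ** Y) = ?N *v column j Y"
      by (simp_all add: column_def matrix_matrix_mult_def matrix_vector_mult_def vec_eq_iff)
    ultimately have "Y *v column j Z = Q (P (Q (h j)))"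
      by (simp add: col clinear_matrix_works[OF clinear_compose[OF P Q]])
    moreover have "Y *v column j Z = (\<Sum>i\<in>UNIV. Z $ i $ j *s Q (h i))"
      unfolding matrix_mult_sum col by (simp add: column_def)
    ultimately have "P (Q (e j)) = P (\<Sum>i\<in>UNIV. Z $ i $ j *s Q (h i))"
      by (simp add: h)
    then have *: "P (Q (e j)) = (\<Sum>i\<in>UNIV. Z $ i $ j *\<^sub>C e i)"
      by (simp add: P_sum)
    have e_rep: "complex_space.representation b (e k) (e i) = (if k = i then 1 else 0)" for k
      using complex_space.representation_basis[OF ind, of "e k"] e by (auto simp: bij_betw_def inj_eq)
    have "e k \<in> complex_space.span b" for k
      using e by (intro complex_space.span_base) (auto simp: bij_betw_def)
    then show ?thesis
      by (simp add: * complex_space.representation_sum[OF ind] complex_space.representation_scale[OF ind]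
          complex_space.span_scale e_rep if_distrib cong: if_cong)
  qed
  then show thesis
    using that[OF e Y] by (simp add: Z_def)
qed

text \<open>In a basis of its range, \<open>P Q\<close> has a matrix similar to that of
  \<open>Q P\<close>, and the trace is invariant under similarity.\<close>

lemma op_trace_commute:
  fixes P :: "complex^'n \<Rightarrow> 'h::complex_hilbert" and Q :: "'h \<Rightarrow> complex^'n"
  assumes P: "clinear P" and Q: "clinear Q"
    and dim: "complex_space.dim (range (\<lambda>x. P (Q x))) = CARD('n)"
  shows "op_trace (\<lambda>x. P (Q x)) = trace (matrix (\<lambda>v. Q (P v)))"
proof -
  define b where "b = range_basis (\<lambda>x. P (Q x))"
  obtain e :: "'n \<Rightarrow> 'h" and Y :: "complex^'n^'n" where e: "bij_betw e UNIV b" and Y: "invertible Y"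
    and rep: "\<forall>i j. complex_space.representation b (P (Q (e j))) (e i) =
      (matrix_inv Y ** matrix (\<lambda>v. Q (P v)) ** Y) $ i $ j"
    by (rule range_basis_representation[OF assms, folded b_def])
  have "op_trace (\<lambda>x. P (Q x)) = (\<Sum>i\<in>UNIV. complex_space.representation b (P (Q (e i))) (e i))"
    unfolding op_trace_def Let_def b_def[symmetric] by (rule sum.reindex_bij_betw[OF e, symmetric])
  also have "\<dots> = trace (matrix_inv Y ** matrix (\<lambda>v. Q (P v)) ** Y)"
    by (simp add: rep trace_def)
  finally show ?thesis
    by (simp add: trace_similar[OF Y])
qed

text \<open>Transport along \<open>e\<close> maps permutations of \<open>'n\<close> to permutations
  of \<open>b\<close> and preserves signs. This turns the sum in \<open>op_det\<close> into an
  ordinary \<open>det\<close>.\<close>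

lemma Leibniz_sum_reindex:
  fixes e :: "'n::finite \<Rightarrow> 'b" and f :: "'b \<Rightarrow> 'b \<Rightarrow> 'a::comm_ring_1"
  assumes e: "bij_betw e UNIV b"
  shows "(\<Sum>p | p permutes b. of_int (sign p) * (\<Prod>x\<in>b. f x (p x))) = det (\<chi> i j. f (e i) (e j))"
proof -
  have bij: "bij_betw (map_permutation UNIV e) {p. p permutes UNIV} {p. p permutes b}"
  proof -
    have "map_permutation UNIV e = (\<lambda>p x. if x \<in> b then e (p (inv_into UNIV e x)) else x)"
      using e by (auto simp: map_permutation_def restrict_id_def fun_eq_iff bij_betw_def)
    then show ?thesis
      using bij_betw_permutations[OF e] by simp
  qed
  have "(\<Sum>p | p permutes b. of_int (sign p) * (\<Prod>x\<in>b. f x (p x))) =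
      (\<Sum>q | q permutes UNIV. of_int (sign (map_permutation UNIV e q)) * (\<Prod>x\<in>b. f x (map_permutation UNIV e q x)))"
    by (rule sum.reindex_bij_betw[OF bij, symmetric])
  also have "\<dots> = (\<Sum>q | q permutes UNIV. of_int (sign q) * (\<Prod>i\<in>UNIV. f (e i) (e (q i))))"
  proof (rule sum.cong[OF refl])
    fix q :: "'n \<Rightarrow> 'n"
    assume "q \<in> {q. q permutes UNIV}"
    then have "sign (map_permutation UNIV e q) = sign q"
      using e by (intro sign_map_permutation) (auto simp: bij_betw_def)
    moreover have "(\<Prod>x\<in>b. f x (map_permutation UNIV e q x)) =
        (\<Prod>i\<in>UNIV. f (e i) (map_permutation UNIV e q (e i)))"
      by (rule prod.reindex_bij_betw[OF e, symmetric])
    ultimately show "of_int (sign (map_permutation UNIV e q)) * (\<Prod>x\<in>b. f x (map_permutation UNIV e q x)) =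
        of_int (sign q) * (\<Prod>i\<in>UNIV. f (e i) (e (q i)))"
      using e by (simp add: map_permutation_apply bij_betw_def)
  qed
  finally show ?thesis
    by (simp add: det_def)
qed

text \<open>Sylvester's identity: the similarity used for the trace also conjugates
  \<open>I + Q P\<close> into the matrix of \<open>I + P Q\<close> on the range of
  \<open>P Q\<close>.\<close>

lemma op_det_commute:
  fixes P :: "complex^'n \<Rightarrow> 'h::complex_hilbert" and Q :: "'h \<Rightarrow> complex^'n"
  assumes P: "clinear P" and Q: "clinear Q"
    and dim: "complex_space.dim (range (\<lambda>x. P (Q x))) = CARD('n)"
  shows "op_det (\<lambda>x. x + P (Q x)) = det (mat 1 + matrix (\<lambda>v. Q (P v)))"
proof -
  define b where "b = range_basis (\<lambda>x. P (Q x))"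
  let ?N = "matrix (\<lambda>v. Q (P v))"
  obtain e :: "'n \<Rightarrow> 'h" and Y :: "complex^'n^'n" where e: "bij_betw e UNIV b" and Y: "invertible Y"
    and rep: "\<forall>i j. complex_space.representation b (P (Q (e j))) (e i) =
      (matrix_inv Y ** ?N ** Y) $ i $ j"
    by (rule range_basis_representation[OF assms, folded b_def])
  have ind: "complex_space.independent b" and span: "complex_space.span b = range (\<lambda>x. P (Q x))"
    unfolding b_def by (intro range_basis clinear_compose[OF Q P])+
  have e_in: "e j \<in> b" for j
    using e by (auto simp: bij_betw_def)
  have e_rep: "complex_space.representation b (e j) (e i) = mat 1 $ i $ j" for i j
    using complex_space.representation_basis[OF ind e_in, of j] e
    by (auto simp: bij_betw_def inj_eq mat_def)
  have "complex_space.representation b (e j + P (Q (e j))) (e i) =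
      (matrix_inv Y ** (mat 1 + ?N) ** Y) $ i $ j" for i j
  proof -
    have "matrix_inv Y ** (mat 1 + ?N) ** Y = mat 1 + matrix_inv Y ** ?N ** Y"
      by (simp add: matrix_add_ldistrib matrix_add_rdistrib matrix_inv_mult[OF Y])
    moreover have "P (Q (e j)) \<in> complex_space.span b"
      by (simp add: span)
    ultimately show ?thesis
      by (simp add: complex_space.representation_add[OF ind _ complex_space.span_base[OF e_in]] rep e_rep)
  qed
  moreover have "op_det (\<lambda>x. x + P (Q x)) =
      det (\<chi> i j. complex_space.representation b (e i + P (Q (e i))) (e j))"
    using Leibniz_sum_reindex[OF e, of "\<lambda>x y. complex_space.representation b (x + P (Q x)) y"]
    by (simp add: op_det_def Let_def flip: b_def)
  \<comment> \<open>In \<open>op_det\<close> the first index is the argument and the second the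
    coordinate, hence the transpose.\<close>
  ultimately have "op_det (\<lambda>x. x + P (Q x)) = det (transpose (matrix_inv Y ** (mat 1 + ?N) ** Y))"
    by (simp add: transpose_def)
  then show ?thesis
    by (simp only: det_transpose det_similar[OF Y])
qed

lemma invertible_unitary_matrix:
  "unitary_matrix B \<Longrightarrow> invertible B"
  unfolding unitary_matrix_def invertible_def by blast

text \<open>A right inverse of a square matrix over a field is two-sided.\<close>

lemma matrix_inv_unique:
  fixes A :: "'a::field^'n^'n"
  assumes "A ** X = mat 1"
  shows "matrix_inv A = X"
proof -
  have "invertible A"
    using assms matrix_left_right_inverse1 unfolding invertible_def by blast
  then have "matrix_inv A ** (A ** X) = X"
    by (simp add: matrix_mul_assoc matrix_inv_mult)
  then show ?thesis
    by (simp add: assms)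
qed

section \<open>The pair of unitary operators\<close>

theorem theorem5p1:
  fixes Up Um :: "'h::complex_hilbert \<Rightarrow> 'h"
    and B :: "complex^'n^'n"
    and C :: "'h \<Rightarrow> complex^'n"
  assumes "unitary_op Up" and "unitary_op Um"
    and "(\<Inter>l\<in>- sphere 0 1. {x. resolvent Up l x - resolvent Um l x = 0}) = {0}"
    and "\<forall>l\<in>- sphere 0 1.
      complex_space.dim (range (\<lambda>x. resolvent Up l x - resolvent Um l x)) = CARD('n)"
    and "model_of_pair Up Um B C"
  shows "\<forall>l\<in>- sphere 0 1.
    det (matrix_inv B) * op_det (\<lambda>x. resolvent Up l (Um x - l *\<^sub>C x)) = det (caratheodory Up B C l) \<and>
    op_trace (\<lambda>x. resolvent Up l x - resolvent Um l x) =
      trace (matrix_inv (caratheodory Up B C l) ** matrix_deriv (caratheodory Up B C) l)"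
proof
  fix l :: complex
  assume l: "l \<in> - sphere 0 1"
  note Up = assms(1) and Um = assms(2)
  let ?V = "cadjoint Up" and ?\<Phi> = "caratheodory Up B C"
  from assms(5) have C: "bounded_clinear C" and B: "invertible B"
    and model: "\<And>x. x - ?V (Um x) = - cadjoint C (B *v C x)"
    by (auto simp: model_of_pair_def invertible_unitary_matrix)
  define R where "R = (\<lambda>z. inv (\<lambda>x. x - z *\<^sub>C ?V x))"
  define P where "P = (\<lambda>v. R l (cadjoint C (B *v v)))"
  \<comment> \<open>\<open>G\<close> is the matrix of \<open>I + C P\<close>, identified in
    \<open>\<Phi>_B\<close> with the Caratheodory matrix times \<open>B\<close>; \<open>N\<close> is
    the matrix whose trace is that of the resolvent difference.\<close>
  define G where "G = mat 1 + matrix (\<lambda>v. C (P v))"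
  define N where "N = matrix (\<lambda>v. C (resolvent Um l (P v)))"
  have bij: "bij (\<lambda>x. Up x - l *\<^sub>C x)" "bij (\<lambda>x. Um x - l *\<^sub>C x)" "bij (\<lambda>x. x - l *\<^sub>C ?V x)"
    using bij_diff_unitary Up Um l by blast+
  have linU: "clinear Up" "clinear Um" and linV: "clinear ?V"
    using Up Um by (simp_all add: unitary_op_def bounded_clinear_clinear clinear_cadjoint)
  have linC: "clinear C" and linC': "clinear (cadjoint C)"
    using C by (simp_all add: bounded_clinear_clinear clinear_cadjoint)
  have linR: "clinear (R z)" if "z \<in> - sphere 0 1" for z
    unfolding R_def
  proof (rule clinear_inv[OF _ bij_diff_unitary(2)[OF Up that]])
    show "clinear (\<lambda>x. x - z *\<^sub>C ?V x)"
      using linV by (simp add: clinear_iff complex_space.scale_right_distrib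
          complex_space.scale_right_diff_distrib mult.commute)
  qed
  have linRm: "clinear (resolvent Um l)"
    unfolding resolvent_def
  proof (rule clinear_inv[OF _ bij(2)])
    show "clinear (\<lambda>x. Um x - l *\<^sub>C x)"
      using linU(2) by (simp add: clinear_iff complex_space.scale_right_distrib
          complex_space.scale_right_diff_distrib mult.commute)
  qed
  have linP: "clinear P"
    unfolding P_def
    by (rule clinear_compose[OF clinear_compose[OF clinear_matrix_vector_mult linC'] linR[OF l]])
  have R: "R l x - l *\<^sub>C ?V (R l x) = x" for x
    using surj_f_inv_f[OF bij_is_surj[OF bij(3)]] by (simp add: R_def)
  have Um_resolvent: "Um (resolvent Um l x) - l *\<^sub>C resolvent Um l x = x" for x
    using surj_f_inv_f[OF bij_is_surj[OF bij(2)]] by (simp add: resolvent_def)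
  have resolvent_eqI: "resolvent Up l x = y" if "Up y - l *\<^sub>C y = x" for x y
    using inv_f_f[OF bij_is_inj[OF bij(1)], of y] that by (simp add: resolvent_def)

  \<comment> \<open>Apply \<open>Up - l\<close> to the right-hand side. The model relation rewrites
    \<open>Um x\<close>, and \<open>Up - l\<close> factors as \<open>Up\<close> after
    \<open>I - l ?V\<close>, whose second factor cancels the \<open>R l\<close> in
    \<open>P\<close>.\<close>
  have pencil: "resolvent Up l (Um x - l *\<^sub>C x) = x + P (C x)" for x
  proof (rule resolvent_eqI)
    have "?V (Um x) = x + cadjoint C (B *v C x)"
      using model[of x] by (simp add: algebra_simps)
    then have "Um x = Up (x + cadjoint C (B *v C x))"
      using unitary_op_cadjoint(2)[OF Up] by metis
    moreover have "Up (P (C x)) - l *\<^sub>C P (C x) = Up (cadjoint C (B *v C x))"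
    proof -
      have "Up (P (C x)) = Up (cadjoint C (B *v C x) + l *\<^sub>C ?V (P (C x)))"
        using R[of "cadjoint C (B *v C x)"] by (simp add: P_def diff_eq_eq)
      also have "\<dots> = Up (cadjoint C (B *v C x)) + l *\<^sub>C P (C x)"
        by (simp add: clinear_add[OF linU(1)] clinear_scaleC[OF linU(1)] unitary_op_cadjoint[OF Up])
      finally show ?thesis
        by simp
    qed
    ultimately show "Up (x + P (C x)) - l *\<^sub>C (x + P (C x)) = Um x - l *\<^sub>C x"
      by (simp add: clinear_add[OF linU(1)] complex_space.scale_right_distrib algebra_simps)
  qed
  have resolvent_diff: "resolvent Up l x - resolvent Um l x = P (C (resolvent Um l x))" for x
    using pencil[of "resolvent Um l x"] by (simp add: Um_resolvent)
  \<comment> \<open>This form contributes the factor \<open>?V\<close> that occurs in the derivative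
    of \<open>?\<Phi>\<close>.\<close>
  have resolvent_R: "resolvent Up l x = R l (?V x)" for x
  proof (rule resolvent_eqI)
    have "Up (R l (?V x)) = Up (?V x + l *\<^sub>C ?V (R l (?V x)))"
      using R[of "?V x"] by (simp add: diff_eq_eq)
    then show "Up (R l (?V x)) - l *\<^sub>C R l (?V x) = x"
      by (simp add: clinear_add[OF linU(1)] clinear_scaleC[OF linU(1)] unitary_op_cadjoint[OF Up])
  qed

  \<comment> \<open>The matrix of \<open>I + C P\<close> and the determinant formula\<close>
  have \<Phi>: "?\<Phi> z = matrix_inv B + matrix (\<lambda>v. C (R z (cadjoint C v)))" for z
    by (simp add: caratheodory_def R_def)
  have linCRC: "clinear (\<lambda>v. C (R l (cadjoint C v)))"
    by (rule clinear_compose[OF clinear_compose[OF linC' linR[OF l]] linC])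
  have G_v: "G *v v = v + C (P v)" for v
    by (simp add: G_def matrix_vector_mult_add_rdistrib clinear_matrix_works[OF clinear_compose[OF linP linC]])
  have \<Phi>_B: "?\<Phi> l ** B = G"
    unfolding matrix_eq
    by (simp add: \<Phi> G_v matrix_add_rdistrib matrix_inv_mult[OF B] matrix_vector_mult_add_rdistrib P_def
        clinear_matrix_works[OF linCRC] flip: matrix_vector_mul_assoc)
  \<comment> \<open>Injectivity passes from \<open>I + P C\<close> to \<open>I + C P\<close>: if
    \<open>v + C (P v) = 0\<close>, then \<open>P v\<close> is annihilated by
    \<open>I + P C\<close>, which is injective by \<open>pencil\<close>. So \<open>P v = 0\<close>,
    and then \<open>v = 0\<close>.\<close>
  have "v = 0" if "G *v v = 0" for v
  proof -
    have "v + C (P v) = 0"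
      using that by (simp add: G_v)
    then have "P v + P (C (P v)) = 0"
      using clinear_add[OF linP, of v "C (P v)"] clinear_scaleC[OF linP, of 0 0] by simp
    then have "resolvent Up l (Um (P v) - l *\<^sub>C P v) = resolvent Up l (Um 0 - l *\<^sub>C 0)"
      using pencil[of "P v"] pencil[of 0] clinear_scaleC[OF linP, of 0 0] clinear_scaleC[OF linC, of 0 0] by simp
    then have "Um (P v) - l *\<^sub>C P v = Um 0 - l *\<^sub>C 0"
      unfolding resolvent_def by (rule injD[OF bij_is_inj[OF bij_imp_bij_inv[OF bij(1)]]])
    then have "P v = 0"
      by (rule injD[OF bij_is_inj[OF bij(2)]])
    then show "v = 0"
      using \<open>v + C (P v) = 0\<close> clinear_scaleC[OF linC, of 0 0] by simp
  qed
  then have G: "invertible G"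
    using matrix_left_invertible_ker[of G] invertible_left_inverse by blast

  \<comment> \<open>Surjectivity of the resolvent of \<open>Um\<close> transfers the dimension
    hypothesis from the resolvent difference to \<open>P C\<close>, as \<open>op_det_commute\<close>
    requires.\<close>
  have range_PC: "range (\<lambda>x. P (C x)) = range (\<lambda>x. resolvent Up l x - resolvent Um l x)"
  proof -
    have "surj (resolvent Um l)"
      unfolding resolvent_def by (intro bij_is_surj bij_imp_bij_inv bij)
    then have "range (\<lambda>x. P (C (resolvent Um l x))) = range (\<lambda>x. P (C x))"
      by (metis (no_types) image_image)
    then show ?thesis
      by (simp add: resolvent_diff)
  qed
  have dim: "complex_space.dim (range (\<lambda>x. resolvent Up l x - resolvent Um l x)) = CARD('n)"
    using assms(4) l by blast
  have "op_det (\<lambda>x. resolvent Up l (Um x - l *\<^sub>C x)) = det G"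
    unfolding pencil G_def
    by (rule op_det_commute[OF linP linC]) (simp add: range_PC dim)
  also have "\<dots> = det (?\<Phi> l) * det B"
    by (simp add: det_mul flip: \<Phi>_B)
  finally have "det (matrix_inv B) * op_det (\<lambda>x. resolvent Up l (Um x - l *\<^sub>C x)) =
      det (?\<Phi> l) * det (B ** matrix_inv B)"
    by (simp add: det_mul)
  then have det: "det (matrix_inv B) * op_det (\<lambda>x. resolvent Up l (Um x - l *\<^sub>C x)) = det (?\<Phi> l)"
    by (simp add: matrix_inv_mult[OF B])

  \<comment> \<open>The derivative of the Caratheodory function and the trace formula\<close>
  define D where "D = matrix (\<lambda>v. C (R l (?V (R l (cadjoint C v)))))"
  have linD: "clinear (\<lambda>v. C (R l (?V (R l (cadjoint C v)))))"
    by (rule clinear_compose[OF clinear_compose[OF clinear_compose[OF clinear_compose[OF linC' linR[OF l]] linV] linR[OF l]] linC])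
  have "matrix_deriv ?\<Phi> l $ i $ j = D $ i $ j" for i j
  proof -
    \<comment> \<open>A coordinate of \<open>C\<close> serves as the functional in the derivative
      lemma, and the image of a unit vector under \<open>cadjoint C\<close> as the fixed vector;
      this gives the derivative entry by entry.\<close>
    have "bounded_clinear (\<lambda>x. C x $ i)"
      using bounded_linear_compose[OF bounded_linear_vec_nth[of i] bounded_clinearD(1)[OF C]]
      by (simp add: bounded_clinear_def bounded_clinearD(6)[OF C] scaleC_vec_def scaleC_complex_def)
    from DERIV_inv_diff_unitary[OF Up l this, of "cadjoint C (axis j 1)"]
    have "((\<lambda>z. matrix_inv B $ i $ j + C (R z (cadjoint C (axis j 1))) $ i) has_field_derivative
        0 + C (R l (?V (R l (cadjoint C (axis j 1))))) $ i) (at l)"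
      unfolding R_def by (intro DERIV_add DERIV_const)
    then show ?thesis
      by (simp add: matrix_deriv_def \<Phi> D_def matrix_def DERIV_imp_deriv)
  qed
  then have deriv: "matrix_deriv ?\<Phi> l = D"
    by (simp add: vec_eq_iff)
  \<comment> \<open>On \<open>v\<close>, the left side is \<open>C (y + P (C y))\<close> with
    \<open>y = resolvent Um l (P v)\<close>. By \<open>resolvent_diff\<close> this is
    \<open>C (resolvent Up l (P v))\<close>, which \<open>resolvent_R\<close> turns into the right
    side.\<close>
  have "G ** N = D ** B"
    unfolding matrix_eq
  proof
    fix v
    define y where "y = resolvent Um l (P v)"
    have "N *v v = C y"
      unfolding N_def y_def by (rule clinear_matrix_works[OF clinear_compose[OF clinear_compose[OF linP linRm] linC]])
    then have "(G ** N) *v v = C (y + P (C y))"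
      by (simp add: G_v clinear_add[OF linC] flip: matrix_vector_mul_assoc)
    also have "y + P (C y) = resolvent Up l (P v)"
      using resolvent_diff[of "P v"] by (simp add: y_def algebra_simps)
    also have "C (resolvent Up l (P v)) = (D ** B) *v v"
      by (simp add: resolvent_R P_def D_def clinear_matrix_works[OF linD] flip: matrix_vector_mul_assoc)
    finally show "(G ** N) *v v = (D ** B) *v v" .
  qed
  then have "matrix_inv G ** (G ** N) = matrix_inv G ** (D ** B)"
    by simp
  then have N: "N = matrix_inv G ** D ** B"
    by (simp add: matrix_mul_assoc matrix_inv_mult[OF G])
  \<comment> \<open>Inverting \<open>\<Phi>_B\<close> lets cyclicity of the trace move the trailing
    factor \<open>B\<close> of \<open>N\<close> to the front.\<close>
  have "matrix_inv (?\<Phi> l) = B ** matrix_inv G"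
    by (rule matrix_inv_unique) (simp add: matrix_mul_assoc \<Phi>_B matrix_inv_mult[OF G])
  then have "trace N = trace (matrix_inv (?\<Phi> l) ** D)"
    using trace_mul_sym[of "matrix_inv G ** D" B] by (simp add: N matrix_mul_assoc)
  \<comment> \<open>The resolvent difference factors through \<open>complex^'n\<close> as
    \<open>P\<close> after \<open>C (resolvent Um l x)\<close>, and \<open>N\<close> is the product
    in the other order.\<close>
  moreover have "op_trace (\<lambda>x. resolvent Up l x - resolvent Um l x) = trace N"
    unfolding resolvent_diff N_def
    by (rule op_trace_commute[OF linP clinear_compose[OF linRm linC]]) (use dim in \<open>simp add: resolvent_diff\<close>)
  ultimately show "det (matrix_inv B) * op_det (\<lambda>x. resolvent Up l (Um x - l *\<^sub>C x)) = det (?\<Phi> l) \<and>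
      op_trace (\<lambda>x. resolvent Up l x - resolvent Um l x) =
        trace (matrix_inv (?\<Phi> l) ** matrix_deriv ?\<Phi> l)"
    using det by (simp add: deriv)
qed

end
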